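(* Let $(Z,T)$ be a discrete topological system on a compact metrizable space, let $f:Z\to\{1\}$ be the constant function $1$, and let $a>0$. Then $(Z,T)$ can be strongly embedded in $\mathcal{B}(a)$ if and only if the suspension flow $(Z_f,T_f)$ can be embedded in $\mathcal{B}(a)$.
   Context: A discrete topological system $(Z,T)$ is a compact metrizable space $Z$ with a homeomorphism $T:Z\to Z$. Suspension flow: for continuous $f:Z\to(0,\infty)$, $Z_f=\{(x,t):x\in Z,\ 0\le t\le f(x)\}/\big((x,f(x))\sim(Tx,0)\big)$, and $(Z_f,T_f)$ is the flow on $Z_f$ induced by the time translation $(x,s)\mapsto(x,s+t)$, $t\in\mathbb{R}$. Band-limited functions: $\mathcal{B}(a)$ is the space of all continuous $f:\mathbb{R}\to\mathbb{R}$ with $\|f\|_\infty\le1$ whose Fourier transform $\mathcal{F}(f)$ (as a tempered distribution, normalized by $\mathcal{F}(f)(\xi)=\int_{\mathbb{R}} f(x)e^{-2\pi i\xi x}\,dx$) has support contained in $[-\frac a2,\frac a2]$. It is compact under the metric $d(f,g)=\sum_{n\ge1}2^{-n}\sup_{|x|\le n}|f(x)-g(x)|$. $\mathbb{R}$ acts on it by the shift $\tau_r(f)(x)=f(x+r)$. A flow $(X,\Phi)$ can be embedded in $\mathcal{B}(a)$ if there is a continuous injective $H:X\to\mathcal{B}(a)$ with $H\circ\Phi_r=\tau_r\circ H$ for all $r\in\mathbb{R}$. $(Z,T)$ can be strongly embedded in $\mathcal{B}(a)$ if there is a continuous injective $h:Z\to\mathcal{B}(a)$ with $h\circ T=\tau_1\circ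 h$ such that whenever $x,x'\in Z$ and $r\in\mathbb{R}$ satisfy $\tau_r(h(x))=h(x')$, then $r\in\mathbb{Z}$ and $x'=T^rx$. *)

theory Defs
  imports "HOL-Analysis.Analysis"
begin

section \<open>Discrete systems and suspension flows\<close>

text \<open>Spaces are given as abstract topologies, so a system lives on \<open>topspace Z\<close>; the values of
  \<open>T\<close> outside it are irrelevant.\<close>

definition discrete_system :: "'z topology \<Rightarrow> ('z \<Rightarrow> 'z) \<Rightarrow> bool" where
  "discrete_system Z T \<longleftrightarrow> compact_space Z \<and> metrizable_space Z \<and> homeomorphic_map Z Z T"

definition int_iterate :: "'z topology \<Rightarrow> ('z \<Rightarrow> 'z) \<Rightarrow> int \<Rightarrow> 'z \<Rightarrow> 'z" where
  "int_iterate Z T n =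
     (if 0 \<le> n then T ^^ nat n else inv_into (topspace Z) T ^^ nat (- n))"

definition quotient_topology :: "'a topology \<Rightarrow> ('a \<times> 'a) set \<Rightarrow> 'a set topology" where
  "quotient_topology X R =
     topology (\<lambda>U. U \<subseteq> topspace X // R \<and> openin X {x \<in> topspace X. R `` {x} \<in> U})"

lemma istopology_quotient_topology:
  "istopology (\<lambda>U. U \<subseteq> topspace X // R \<and> openin X {x \<in> topspace X. R `` {x} \<in> U})"
proof -
  have "openin X {x \<in> topspace X. R `` {x} \<in> S \<inter> T}"
    if "openin X {x \<in> topspace X. R `` {x} \<in> S}" "openin X {x \<in> topspace X. R `` {x} \<in> T}" for S T
  proof -
    have "{x \<in> topspace X. R `` {x} \<in> S \<inter> T}
        = {x \<in> topspace X. R `` {x} \<in> S} \<inter> {x \<in> topspace X. R `` {x} \<in> T}" by auto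
    then show ?thesis using that by (simp add: openin_Int)
  qed
  moreover have "openin X {x \<in> topspace X. R `` {x} \<in> \<Union>\<K>}"
    if "\<forall>K\<in>\<K>. openin X {x \<in> topspace X. R `` {x} \<in> K}" for \<K>
  proof -
    have "{x \<in> topspace X. R `` {x} \<in> \<Union>\<K>} = (\<Union>K\<in>\<K>. {x \<in> topspace X. R `` {x} \<in> K})" by auto
    then show ?thesis using that by auto
  qed
  ultimately show ?thesis unfolding istopology_def by (auto simp: le_infI1)
qed

lemma openin_quotient_topology:
  "openin (quotient_topology X R) U \<longleftrightarrow>
     U \<subseteq> topspace X // R \<and> openin X {x \<in> topspace X. R `` {x} \<in> U}"
  unfolding quotient_topology_def
  by (simp add: topology_inverse'[OF istopology_quotient_topology])

lemma topspace_quotient_topology [simp]: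
  "topspace (quotient_topology X R) = topspace X // R"
proof -
  have "{x \<in> topspace X. R `` {x} \<in> topspace X // R} = topspace X"
    by (auto intro: quotientI)
  then have "openin (quotient_topology X R) (topspace X // R)"
    by (simp add: openin_quotient_topology)
  then show ?thesis
    by (meson openin_quotient_topology openin_subset openin_topspace subset_antisym)
qed

text \<open>In the following definitions the roof function \<open>f\<close> is meant to be continuous and positive
  on \<open>topspace Z\<close>.\<close>

definition suspension_domain :: "'z topology \<Rightarrow> ('z \<Rightarrow> real) \<Rightarrow> ('z \<times> real) set" where
  "suspension_domain Z f = {(x, t). x \<in> topspace Z \<and> 0 \<le> t \<and> t \<le> f x}"

inductive suspension_glue ::
  "'z topology \<Rightarrow> ('z \<Rightarrow> 'z) \<Rightarrow> ('z \<Rightarrow> real) \<Rightarrow> 'z \<times> real \<Rightarrow> 'z \<times> real \<Rightarrow> bool"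
  for Z T f where
  "x \<in> topspace Z \<Longrightarrow> suspension_glue Z T f (x, f x) (T x, 0)"

definition suspension_rel ::
  "'z topology \<Rightarrow> ('z \<Rightarrow> 'z) \<Rightarrow> ('z \<Rightarrow> real) \<Rightarrow> (('z \<times> real) \<times> ('z \<times> real)) set" where
  "suspension_rel Z T f =
     {(p, q). p \<in> suspension_domain Z f \<and> q \<in> suspension_domain Z f \<and>
              equivclp (suspension_glue Z T f) p q}"

definition suspension ::
  "'z topology \<Rightarrow> ('z \<Rightarrow> 'z) \<Rightarrow> ('z \<Rightarrow> real) \<Rightarrow> ('z \<times> real) set topology" where
  "suspension Z T f =
     quotient_topology (subtopology (prod_topology Z euclideanreal) (suspension_domain Z f))
       (suspension_rel Z T f)"

text \<open>A translated point \<open>(x, s + r)\<close> in general lies outside the fundamental domain. It is brought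
  back by the identification \<open>(x, t) \<sim> (T x, t - f x)\<close>, for \<open>x \<in> topspace Z\<close> and arbitrary real
  \<open>t\<close>, which extends the gluing of the domain.\<close>

inductive suspension_step ::
  "'z topology \<Rightarrow> ('z \<Rightarrow> 'z) \<Rightarrow> ('z \<Rightarrow> real) \<Rightarrow> 'z \<times> real \<Rightarrow> 'z \<times> real \<Rightarrow> bool"
  for Z T f where
  "x \<in> topspace Z \<Longrightarrow> suspension_step Z T f (x, t) (T x, t - f x)"

definition suspension_flow ::
  "'z topology \<Rightarrow> ('z \<Rightarrow> 'z) \<Rightarrow> ('z \<Rightarrow> real) \<Rightarrow> real \<Rightarrow> ('z \<times> real) set \<Rightarrow> ('z \<times> real) set" where
  "suspension_flow Z T f r c =
     {q \<in> suspension_domain Z f. \<exists>(x, s)\<in>c. equivclp (suspension_step Z T f) (x, s + r) q}"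


section \<open>Tempered distributions on the real line\<close>

definition vderiv :: "(real \<Rightarrow> complex) \<Rightarrow> real \<Rightarrow> complex" where
  "vderiv \<phi> = (\<lambda>t. vector_derivative \<phi> (at t))"

definition schwartz :: "(real \<Rightarrow> complex) set" where
  "schwartz = {\<phi>. (\<forall>k t. (vderiv ^^ k) \<phi> differentiable at t) \<and>
                  (\<forall>m k. bounded (range (\<lambda>t. of_real (t ^ m) * (vderiv ^^ k) \<phi> t)))}"

definition fourier :: "(real \<Rightarrow> complex) \<Rightarrow> real \<Rightarrow> complex" where
  "fourier \<phi> = (\<lambda>\<xi>. LINT x|lborel. \<phi> x * exp (- 2 * of_real pi * \<i> * of_real \<xi> * of_real x))"

text \<open>A tempered distribution is represented by its action on \<^const>\<open>schwartz\<close>; its values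
  elsewhere are irrelevant.\<close>

type_synonym distribution = "(real \<Rightarrow> complex) \<Rightarrow> complex"

definition regular_distribution :: "(real \<Rightarrow> real) \<Rightarrow> distribution" where
  "regular_distribution f = (\<lambda>\<phi>. LINT x|lborel. of_real (f x) * \<phi> x)"

definition fourier_distribution :: "distribution \<Rightarrow> distribution" where
  "fourier_distribution u = (\<lambda>\<phi>. u (fourier \<phi>))"

definition function_support :: "(real \<Rightarrow> complex) \<Rightarrow> real set" where
  "function_support \<phi> = closure {t. \<phi> t \<noteq> 0}"

definition distribution_support :: "distribution \<Rightarrow> real set" where
  "distribution_support u =
     - \<Union> {U. open U \<and>
            (\<forall>\<phi>\<in>schwartz. compact (function_support \<phi>) \<and> function_support \<phi> \<subseteq> U \<longrightarrow> u \<phi> = 0)}"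


section \<open>Band-limited functions\<close>

definition band_limited :: "real \<Rightarrow> (real \<Rightarrow> real) set" where
  "band_limited a =
     {f. continuous_on UNIV f \<and> (\<forall>x. \<bar>f x\<bar> \<le> 1) \<and>
         distribution_support (fourier_distribution (regular_distribution f)) \<subseteq> {- a / 2..a / 2}}"

text \<open>The series starts at \<open>n = 1\<close>, hence the \<^const>\<open>Suc\<close>.\<close>

definition bl_dist :: "(real \<Rightarrow> real) \<Rightarrow> (real \<Rightarrow> real) \<Rightarrow> real" where
  "bl_dist f g =
     (\<Sum>n. (1 / 2) ^ Suc n * (SUP x\<in>{- real (Suc n)..real (Suc n)}. \<bar>f x - g x\<bar>))"

text \<open>The locale \<^locale>\<open>Metric_space\<close> asks for non-negativity and symmetry on the whole type, where the
  suprema need not exist, so the distance is cut off outside the space of band-limited functions.\<close>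

definition band_limited_dist :: "real \<Rightarrow> (real \<Rightarrow> real) \<Rightarrow> (real \<Rightarrow> real) \<Rightarrow> real" where
  "band_limited_dist a f g =
     (if f \<in> band_limited a \<and> g \<in> band_limited a then bl_dist f g else 0)"

lemma Metric_space_band_limited: "Metric_space (band_limited a) (band_limited_dist a)"
proof -
  let ?B = "band_limited a"
  define s where "s f g n = (SUP x\<in>{- real (Suc n)..real (Suc n)}. \<bar>f x - g x :: real\<bar>)" for f g n
  have d: "bl_dist f g = (\<Sum>n. (1 / 2) ^ Suc n * s f g n)" for f g
    unfolding bl_dist_def s_def ..
  have le2: "\<bar>f x - g x\<bar> \<le> 2" if "f \<in> ?B" "g \<in> ?B" for f g x
  proof -
    have "\<bar>f x\<bar> \<le> 1" "\<bar>g x\<bar> \<le> 1" using that by (auto simp: band_limited_def)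
    then show ?thesis by linarith
  qed
  have up: "\<bar>f x - g x\<bar> \<le> s f g n"
    if "f \<in> ?B" "g \<in> ?B" "x \<in> {- real (Suc n)..real (Suc n)}" for f g x n
    unfolding s_def by (rule cSUP_upper[OF that(3)]) (auto intro!: bdd_aboveI2 le2 that)
  have least: "s f g n \<le> c"
    if "\<And>x. x \<in> {- real (Suc n)..real (Suc n)} \<Longrightarrow> \<bar>f x - g x\<bar> \<le> c" for f g n c
    unfolding s_def by (rule cSUP_least) (use that in auto)
  have s0: "0 \<le> s f g n" if "f \<in> ?B" "g \<in> ?B" for f g n
    using up[OF that, of 0 n] by simp
  have sm: "summable (\<lambda>n. (1 / 2) ^ Suc n * s f g n)" if fg: "f \<in> ?B" "g \<in> ?B" for f g
  proof (rule summable_comparison_test')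
    show "summable (\<lambda>n. (1 / 2 :: real) ^ n)" by simp
    show "norm ((1 / 2) ^ Suc n * s f g n) \<le> (1 / 2) ^ n" if "n \<ge> 0" for n
      using s0[OF fg, of n] least[of n f g 2] le2[OF fg] by (simp add: abs_mult field_simps)
  qed
  have comm: "bl_dist f g = bl_dist g f" for f g
    unfolding d s_def by (simp add: abs_minus_commute)
  have nonneg: "0 \<le> bl_dist f g" if "f \<in> ?B" "g \<in> ?B" for f g
    unfolding d using s0[OF that] by (intro suminf_nonneg sm that) auto
  have zero: "bl_dist f g = 0 \<longleftrightarrow> f = g" if fg: "f \<in> ?B" "g \<in> ?B" for f g
  proof
    assume "bl_dist f g = 0"
    then have *: "s f g n = 0" for n
      using suminf_eq_zero_iff[OF sm[OF fg]] s0[OF fg] by (simp add: d)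
    show "f = g"
    proof
      fix x
      obtain n where "\<bar>x\<bar> \<le> real n" using real_arch_simple by blast
      then have "x \<in> {- real (Suc n)..real (Suc n)}" by auto
      from up[OF fg this] * show "f x = g x" by simp
    qed
  qed (simp add: d s_def)
  have triangle: "bl_dist f h \<le> bl_dist f g + bl_dist g h"
    if fgh: "f \<in> ?B" "g \<in> ?B" "h \<in> ?B" for f g h
  proof -
    have "s f h n \<le> s f g n + s g h n" for n
    proof (rule least)
      fix x assume x: "x \<in> {- real (Suc n)..real (Suc n)}"
      show "\<bar>f x - h x\<bar> \<le> s f g n + s g h n"
        using up[OF fgh(1,2) x] up[OF fgh(2,3) x] by linarith
    qed
    then have "bl_dist f h \<le> (\<Sum>n. (1 / 2) ^ Suc n * s f g n + (1 / 2) ^ Suc n * s g h n)"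
      unfolding d using fgh
      by (intro suminf_le summable_add sm) (auto simp flip: distrib_left)
    also have "\<dots> = bl_dist f g + bl_dist g h"
      unfolding d using fgh by (intro suminf_add[symmetric] sm)
    finally show ?thesis .
  qed
  show ?thesis
    by unfold_locales
      (auto simp: band_limited_dist_def nonneg comm zero intro: triangle)
qed

definition band_limited_space :: "real \<Rightarrow> (real \<Rightarrow> real) topology" where
  "band_limited_space a = Metric_space.mtopology (band_limited a) (band_limited_dist a)"

definition shift :: "real \<Rightarrow> (real \<Rightarrow> real) \<Rightarrow> real \<Rightarrow> real" where
  "shift r f = (\<lambda>x. f (x + r))"


section \<open>Embeddings\<close>

definition flow_embeds :: "'x topology \<Rightarrow> (real \<Rightarrow> 'x \<Rightarrow> 'x) \<Rightarrow> real \<Rightarrow> bool" where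
  "flow_embeds X \<Phi> a \<longleftrightarrow>
     (\<exists>H. continuous_map X (band_limited_space a) H \<and> inj_on H (topspace X) \<and>
          (\<forall>r. \<forall>p\<in>topspace X. H (\<Phi> r p) = shift r (H p)))"

definition strongly_embeds :: "'z topology \<Rightarrow> ('z \<Rightarrow> 'z) \<Rightarrow> real \<Rightarrow> bool" where
  "strongly_embeds Z T a \<longleftrightarrow>
     (\<exists>h. continuous_map Z (band_limited_space a) h \<and> inj_on h (topspace Z) \<and>
          (\<forall>x\<in>topspace Z. h (T x) = shift 1 (h x)) \<and>
          (\<forall>x\<in>topspace Z. \<forall>x'\<in>topspace Z. \<forall>r. shift r (h x) = h x' \<longrightarrow>
             (\<exists>n::int. r = of_int n \<and> x' = int_iterate Z T n x)))"

end

theory Submission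
  imports Defs
begin

text \<open>Let \<open>[x, t]\<close> be the point of the suspension given by \<open>(x, t)\<close>. A map \<open>h\<close> on \<open>Z\<close> with
  \<open>h \<circ> T = shift 1 \<circ> h\<close> and an equivariant map \<open>H\<close> on the suspension determine each other by
  \<open>H [x, t] = shift t (h x)\<close> and \<open>h x = H [x, 0]\<close>. The first formula is compatible with
  \<open>(x, 1) \<sim> (T x, 0)\<close> exactly because of the relation on \<open>h\<close>. Under this correspondence strong
  embeddings are the maps \<open>h\<close> for which \<open>H\<close> is injective: \<open>H [x, s] = H [x', s']\<close> says
  \<open>shift (s - s') (h x) = h x'\<close>, and \<open>[x, s] = [x', s']\<close> says that \<open>s - s'\<close> is an integer \<open>n\<close>
  with \<open>x' = T\<^sup>n x\<close>.

  Two facts carry this. The shift must act continuously on the band-limited functions. It maps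
  this space to itself (\<open>shift_band_limited\<close>) because on the Fourier side it multiplies test
  functions by a character, which leaves their supports alone; joint continuity
  (\<open>continuous_map_shift\<close>) holds because the metric is that of uniform convergence on compact
  intervals. Then the quotient must be understood: the gluing on \<open>Z \<times> [0, 1]\<close> and the
  identification \<open>(x, t) \<sim> (T x, t - 1)\<close> on \<open>Z \<times> \<real>\<close>, which defines the flow, have the same normal
  form \<open>(T\<^sup>n x, t - n)\<close> with \<open>n = \<lfloor>t\<rfloor>\<close> (\<open>suspension_rel_iff\<close> and
  \<open>equivclp_step_iff_rep_eq\<close>), so that the flow takes \<open>[x, s]\<close> to \<open>[x, s + r]\<close> in normal form
  (\<open>suspension_flow_cls\<close>).\<close>


section \<open>Shift invariance of the space of band-limited functions\<close>

lemma vderiv_affine: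
  assumes "\<And>t. g differentiable at t" "\<And>t. h differentiable at t"
  shows "vderiv (\<lambda>t. c * g t + h t) = (\<lambda>t. c * vderiv g t + vderiv h t)"
proof
  fix t
  have "(g has_vector_derivative vderiv g t) (at t)" "(h has_vector_derivative vderiv h t) (at t)"
    using assms by (auto simp: vderiv_def vector_derivative_works)
  then have "((\<lambda>t. c * g t + h t) has_vector_derivative c * vderiv g t + vderiv h t) (at t)"
    by (intro has_vector_derivative_add has_vector_derivative_mult_right)
  then show "vderiv (\<lambda>t. c * g t + h t) t = c * vderiv g t + vderiv h t"
    by (simp add: vderiv_def vector_derivative_at)
qed

lemma schwartz_vderiv:
  assumes "\<phi> \<in> schwartz" shows "vderiv \<phi> \<in> schwartz"
proof -
  have "(vderiv ^^ k) (vderiv \<phi>) = (vderiv ^^ Suc k) \<phi>" for k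
    by (simp add: funpow_swap1)
  then show ?thesis
    using assms unfolding schwartz_def by (auto simp del: funpow.simps)
qed

lemma schwartz_affine:
  assumes g: "g \<in> schwartz" and h: "h \<in> schwartz"
  shows "(\<lambda>t. c * g t + h t) \<in> schwartz"
proof -
  have diff: "(vderiv ^^ k) g differentiable at t" "(vderiv ^^ k) h differentiable at t" for k t
    using g h by (auto simp: schwartz_def)
  have eq: "(vderiv ^^ k) (\<lambda>t. c * g t + h t) = (\<lambda>t. c * (vderiv ^^ k) g t + (vderiv ^^ k) h t)" for k
    by (induction k) (simp_all add: vderiv_affine diff)
  have "bounded (range (\<lambda>t. of_real (t ^ m) * (c * (vderiv ^^ k) g t + (vderiv ^^ k) h t)))" for m k
  proof -
    have "bounded (range (\<lambda>t. of_real (t ^ m) * (vderiv ^^ k) g t))"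
      and "bounded (range (\<lambda>t. of_real (t ^ m) * (vderiv ^^ k) h t))"
      using g h by (auto simp: schwartz_def)
    then obtain A B where A: "\<And>t. norm (of_real (t ^ m) * (vderiv ^^ k) g t) \<le> A"
      and B: "\<And>t. norm (of_real (t ^ m) * (vderiv ^^ k) h t) \<le> B"
      unfolding bounded_iff by blast
    have "norm (of_real (t ^ m) * (c * (vderiv ^^ k) g t + (vderiv ^^ k) h t)) \<le> norm c * A + B" for t
    proof -
      have "of_real (t ^ m) * (c * (vderiv ^^ k) g t + (vderiv ^^ k) h t)
          = c * (of_real (t ^ m) * (vderiv ^^ k) g t) + of_real (t ^ m) * (vderiv ^^ k) h t"
        by (simp add: algebra_simps)
      also have "norm \<dots> \<le> norm c * norm (of_real (t ^ m) * (vderiv ^^ k) g t)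
          + norm (of_real (t ^ m) * (vderiv ^^ k) h t)"
        by (metis norm_triangle_ineq norm_mult)
      also have "\<dots> \<le> norm c * A + B"
        by (intro add_mono mult_left_mono A B) auto
      finally show ?thesis .
    qed
    then show ?thesis unfolding bounded_iff by blast
  qed
  moreover have "(\<lambda>t. c * (vderiv ^^ k) g t + (vderiv ^^ k) h t) differentiable at t" for k t
    by (intro differentiable_add differentiable_mult differentiable_const diff)
  ultimately show ?thesis by (simp add: schwartz_def eq)
qed

definition modulation :: "real \<Rightarrow> real \<Rightarrow> complex" where
  "modulation c = (\<lambda>t. exp (\<i> * of_real c * of_real t))"

lemma norm_modulation [simp]: "norm (modulation c t) = 1"
  by (simp add: modulation_def norm_exp_eq_Re)

lemma modulation_nonzero [simp]: "modulation c t \<noteq> 0"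
  by (simp add: modulation_def)

lemma has_vector_derivative_modulation:
  "(modulation c has_vector_derivative \<i> * of_real c * modulation c t) (at t)"
proof -
  have "((\<lambda>z. exp (\<i> * of_real c * z)) has_field_derivative \<i> * of_real c * modulation c t) (at (of_real t))"
    by (auto intro!: derivative_eq_intros simp: modulation_def)
  from has_vector_derivative_real_field[OF this] show ?thesis
    by (simp add: modulation_def)
qed

text \<open>By the Leibniz rule every derivative of \<open>e \<cdot> \<phi>\<close>, where \<open>e\<close> is a character, is again \<open>e\<close> times
  a Schwartz function: \<open>(e \<cdot> g)' = e \<cdot> (i c g + g')\<close>. Since \<open>\<bar>e\<bar> = 1\<close>, the decay
  of these derivatives is that of their Schwartz factors.\<close>

lemma schwartz_modulation:
  assumes \<phi>: "\<phi> \<in> schwartz"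
  shows "(\<lambda>t. modulation c t * \<phi> t) \<in> schwartz"
proof -
  have deriv: "((\<lambda>t. modulation c t * g t) has_vector_derivative
      modulation c t * (\<i> * of_real c * g t + vderiv g t)) (at t)" if "g \<in> schwartz" for g t
  proof -
    have "(vderiv ^^ 0) g differentiable at t" using that unfolding schwartz_def by blast
    then have "(g has_vector_derivative vderiv g t) (at t)"
      by (simp add: vderiv_def vector_derivative_works)
    from has_vector_derivative_mult[OF has_vector_derivative_modulation this]
    show ?thesis by (rule has_vector_derivative_eq_rhs) (simp add: algebra_simps)
  qed
  have ex: "\<exists>g\<in>schwartz. (vderiv ^^ k) (\<lambda>t. modulation c t * \<phi> t) = (\<lambda>t. modulation c t * g t)" for k
  proof (induction k)
    case 0
    then show ?case using \<phi> by auto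
  next
    case (Suc k)
    then obtain g where g: "g \<in> schwartz"
      "(vderiv ^^ k) (\<lambda>t. modulation c t * \<phi> t) = (\<lambda>t. modulation c t * g t)" by blast
    have "(vderiv ^^ Suc k) (\<lambda>t. modulation c t * \<phi> t)
        = (\<lambda>t. modulation c t * (\<i> * of_real c * g t + vderiv g t))"
      using vector_derivative_at[OF deriv[OF g(1)]] by (simp add: g(2) vderiv_def[of "\<lambda>t. modulation c t * g t"])
    then show ?case
      by (intro bexI[where x = "\<lambda>t. \<i> * of_real c * g t + vderiv g t"]
          schwartz_affine[OF g(1) schwartz_vderiv[OF g(1)]])
  qed
  show ?thesis
    unfolding schwartz_def
  proof (intro CollectI conjI allI)
    fix k t
    show "(vderiv ^^ k) (\<lambda>t. modulation c t * \<phi> t) differentiable at t"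
      using ex[of k] deriv by (metis differentiableI_vector)
  next
    fix m k
    obtain g where g: "g \<in> schwartz"
      "(vderiv ^^ k) (\<lambda>t. modulation c t * \<phi> t) = (\<lambda>t. modulation c t * g t)" using ex[of k] by blast
    have "bounded (range (\<lambda>t. of_real (t ^ m) * (vderiv ^^ 0) g t))"
      using g(1) unfolding schwartz_def by blast
    then show "bounded (range (\<lambda>t. of_real (t ^ m) * (vderiv ^^ k) (\<lambda>t. modulation c t * \<phi> t) t))"
      by (simp add: bounded_iff g(2) norm_mult)
  qed
qed

lemma fourier_modulation:
  "fourier (\<lambda>t. modulation (2 * pi * r) t * \<phi> t) \<xi> = fourier \<phi> (\<xi> - r)"
  unfolding fourier_def
proof (rule Bochner_Integration.integral_cong[OF refl])
  fix x
  have "modulation (2 * pi * r) x * exp (- 2 * of_real pi * \<i> * of_real \<xi> * of_real x)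
      = exp (- 2 * of_real pi * \<i> * of_real (\<xi> - r) * of_real x)"
    unfolding modulation_def exp_add[symmetric] by (simp add: algebra_simps)
  then show "modulation (2 * pi * r) x * \<phi> x * exp (- 2 * of_real pi * \<i> * of_real \<xi> * of_real x)
      = \<phi> x * exp (- 2 * of_real pi * \<i> * of_real (\<xi> - r) * of_real x)"
    by (metis (no_types, lifting) mult.commute mult.left_commute)
qed

text \<open>The substitution \<open>x \<mapsto> x - r\<close> moves the shift from the function to the Fourier transform of the
  test function.\<close>

lemma fourier_distribution_shift:
  "fourier_distribution (regular_distribution (shift r f)) \<phi>
     = fourier_distribution (regular_distribution f) (\<lambda>t. modulation (2 * pi * r) t * \<phi> t)"
proof -
  have "(LINT x|lborel. of_real (f x) * fourier \<phi> (x - r))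
      = (LINT x|lborel. of_real (f (r + x)) * fourier \<phi> (r + x - r))"
    using lborel_integral_real_affine[of 1 "\<lambda>x. of_real (f x) * fourier \<phi> (x - r)" r] by simp
  then show ?thesis
    by (simp add: fourier_distribution_def regular_distribution_def shift_def fourier_modulation
        add.commute)
qed

text \<open>Multiplying a test function by a character does not change where it vanishes, so the Fourier
  transforms of a function and of its shift annihilate test functions over the same open sets.\<close>

lemma shift_band_limited:
  assumes "f \<in> band_limited a"
  shows "shift r f \<in> band_limited a"
proof -
  let ?D = "\<lambda>f. fourier_distribution (regular_distribution f)"
  have "?D (shift r f) \<phi> = 0"
    if U: "\<forall>\<phi>\<in>schwartz. compact (function_support \<phi>) \<and> function_support \<phi> \<subseteq> U \<longrightarrow> ?D f \<phi> = 0"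
      and \<phi>: "\<phi> \<in> schwartz" "compact (function_support \<phi>)" "function_support \<phi> \<subseteq> U" for U \<phi>
  proof -
    have "function_support (\<lambda>t. modulation (2 * pi * r) t * \<phi> t) = function_support \<phi>"
      by (simp add: function_support_def)
    with U \<phi> schwartz_modulation[OF \<phi>(1)] show ?thesis
      by (simp add: fourier_distribution_shift)
  qed
  then have "distribution_support (?D (shift r f)) \<subseteq> distribution_support (?D f)"
    unfolding distribution_support_def by blast
  moreover have "continuous_on UNIV (shift r f)"
    using assms unfolding shift_def band_limited_def
    by (auto intro!: continuous_intros continuous_on_compose2[of UNIV f])
  ultimately show ?thesis
    using assms by (auto simp: band_limited_def shift_def)
qed


section \<open>Joint continuity of the shift\<close>

lemma shift_0 [simp]: "shift 0 g = g"
  by (simp add: shift_def)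

lemma shift_shift [simp]: "shift r (shift s g) = shift (r + s) g"
  by (simp add: shift_def add_ac)

lemma band_limited_diff_le_2:
  assumes "f \<in> band_limited a" "g \<in> band_limited a"
  shows "\<bar>f x - g x\<bar> \<le> 2"
proof -
  have "\<bar>f x\<bar> \<le> 1" "\<bar>g x\<bar> \<le> 1" using assms by (auto simp: band_limited_def)
  then show ?thesis by linarith
qed

lemma band_limited_diff_le_SUP:
  assumes "f \<in> band_limited a" "g \<in> band_limited a" "\<bar>x\<bar> \<le> c"
  shows "\<bar>f x - g x\<bar> \<le> (SUP x\<in>{- c..c}. \<bar>f x - g x\<bar>)"
  using assms(3) by (intro cSUP_upper) (auto intro!: bdd_aboveI2 band_limited_diff_le_2[OF assms(1,2)])

lemma bl_dist_summable:
  assumes fg: "f \<in> band_limited a" "g \<in> band_limited a"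
  shows "summable (\<lambda>n. (1 / 2) ^ Suc n * (SUP x\<in>{- real (Suc n)..real (Suc n)}. \<bar>f x - g x\<bar>))"
proof (rule summable_comparison_test')
  show "summable (\<lambda>n. (1 / 2 :: real) ^ n)" by simp
  fix n :: nat
  let ?s = "SUP x\<in>{- real (Suc n)..real (Suc n)}. \<bar>f x - g x\<bar>"
  have "0 \<le> ?s" using band_limited_diff_le_SUP[OF fg, of 0 "real (Suc n)"] by simp
  moreover have "?s \<le> 2" by (rule cSUP_least) (auto intro: band_limited_diff_le_2[OF fg])
  ultimately show "norm ((1 / 2) ^ Suc n * ?s) \<le> (1 / 2) ^ n"
    by (simp add: abs_mult field_simps)
qed

lemma band_limited_diff_le_bl_dist:
  assumes fg: "f \<in> band_limited a" "g \<in> band_limited a" and x: "\<bar>x\<bar> \<le> real (Suc n)"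
  shows "\<bar>f x - g x\<bar> \<le> 2 ^ Suc n * bl_dist f g"
proof -
  define s where "s n = (SUP x\<in>{- real (Suc n)..real (Suc n)}. \<bar>f x - g x\<bar>)" for n
  have s0: "0 \<le> s n" for n
    using band_limited_diff_le_SUP[OF fg, of 0 "real (Suc n)"] by (simp add: s_def)
  have "(1 / 2) ^ Suc n * s n \<le> bl_dist f g"
    using sum_le_suminf[OF bl_dist_summable[OF fg], of "{n}"] s0
    by (simp add: bl_dist_def s_def del: power_Suc)
  then have "2 ^ Suc n * ((1 / 2) ^ Suc n * s n) \<le> 2 ^ Suc n * bl_dist f g"
    by (rule mult_left_mono) simp
  moreover have "2 ^ Suc n * ((1 / 2) ^ Suc n * s n) = s n"
    by (simp add: power_one_over)
  ultimately show ?thesis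
    using band_limited_diff_le_SUP[OF fg x] by (simp only: s_def)
qed

text \<open>The windows of radius at most \<open>N\<close> contribute at most \<open>\<epsilon>\<close> altogether; on the larger ones the
  difference is at most \<open>2\<close>, which gives the geometric tail.\<close>

lemma bl_dist_le:
  assumes fg: "f \<in> band_limited a" "g \<in> band_limited a" and "0 \<le> \<epsilon>"
    and le: "\<And>x. \<bar>x\<bar> \<le> real N \<Longrightarrow> \<bar>f x - g x\<bar> \<le> \<epsilon>"
  shows "bl_dist f g \<le> \<epsilon> + 2 * (1 / 2) ^ N"
proof -
  define s where "s n = (SUP x\<in>{- real (Suc n)..real (Suc n)}. \<bar>f x - g x\<bar>)" for n
  define e where "e n = (if n < N then 0 else (1 / 2) ^ Suc n * (2::real))" for n
  (* e is the tail of the bound 2, vanishing on the first N windows *)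
  have "(\<lambda>n. (1 / 2) ^ Suc n * (2 * (1 / 2) ^ N)) sums (1 * (2 * (1 / 2) ^ N :: real))"
    by (rule sums_mult2[OF power_half_series])
  then have "(\<lambda>n. e (n + N)) sums (2 * (1 / 2) ^ N)"
    by (simp add: e_def power_add mult_ac)
  then have e: "e sums (2 * (1 / 2) ^ N)"
    by (subst (asm) sums_zero_iff_shift) (auto simp: e_def)
  have "(\<lambda>n. (1 / 2) ^ Suc n * \<epsilon>) sums (1 * \<epsilon>)"
    by (rule sums_mult2[OF power_half_series])
  from sums_add[OF this e] have se: "(\<lambda>n. (1 / 2) ^ Suc n * \<epsilon> + e n) sums (\<epsilon> + 2 * (1 / 2) ^ N)"
    by simp
  have term_le: "(1 / 2) ^ Suc n * s n \<le> (1 / 2) ^ Suc n * \<epsilon> + e n" for n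
  proof (cases "n < N")
    case True
    have "s n \<le> \<epsilon>"
      unfolding s_def using True by (intro cSUP_least le) auto
    with True show ?thesis by (simp add: e_def)
  next
    case False
    have "s n \<le> 2"
      unfolding s_def by (intro cSUP_least band_limited_diff_le_2[OF fg]) auto
    then have "s n \<le> \<epsilon> + 2" using \<open>0 \<le> \<epsilon>\<close> by simp
    then have "(1 / 2) ^ Suc n * s n \<le> (1 / 2) ^ Suc n * (\<epsilon> + 2)"
      by (rule mult_left_mono) simp
    with False show ?thesis by (simp add: e_def distrib_left)
  qed
  have "bl_dist f g = (\<Sum>n. (1 / 2) ^ Suc n * s n)"
    by (simp add: bl_dist_def s_def)
  also have "\<dots> \<le> (\<Sum>n. (1 / 2) ^ Suc n * \<epsilon> + e n)"
    using bl_dist_summable[OF fg] se term_le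
    by (intro suminf_le) (auto simp: s_def sums_iff simp del: power_Suc)
  also have "\<dots> = \<epsilon> + 2 * (1 / 2) ^ N" using se by (simp add: sums_iff)
  finally show ?thesis .
qed

text \<open>The metric is that of uniform convergence on compact intervals. Near \<open>(g\<^sub>0, t\<^sub>0)\<close>, replacing
  \<open>g\<close> by \<open>g\<^sub>0\<close> costs little uniformly on a window enlarged by \<open>\<bar>t\<^sub>0\<bar> + 1\<close>, and replacing \<open>t\<close> by
  \<open>t\<^sub>0\<close> costs little because \<open>g\<^sub>0\<close> is uniformly continuous there.\<close>

lemma continuous_map_shift:
  "continuous_map (prod_topology (band_limited_space a) euclideanreal) (band_limited_space a)
     (\<lambda>(g, t). shift t g)"
proof -
  interpret M: Metric_space "band_limited a" "band_limited_dist a"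
    by (rule Metric_space_band_limited)
  have "\<exists>U. openin (prod_topology M.mtopology euclideanreal) U \<and> p0 \<in> U \<and>
          (\<forall>p\<in>U. (case p of (g, t) \<Rightarrow> shift t g) \<in> M.mball (case p0 of (g, t) \<Rightarrow> shift t g) \<epsilon>)"
    if p0: "p0 \<in> topspace (prod_topology M.mtopology euclideanreal)" and \<epsilon>: "0 < \<epsilon>" for p0 \<epsilon>
  proof -
    obtain g0 t0 where p0_eq: "p0 = (g0, t0)" by force
    with p0 have g0: "g0 \<in> band_limited a" by simp
    obtain N where N: "(1 / 2) ^ N < \<epsilon> / 8"
      using real_arch_pow_inv[of "\<epsilon> / 8" "1 / 2"] \<epsilon> by auto
    obtain M where M: "real N + \<bar>t0\<bar> + 1 \<le> real M"
      using real_arch_simple by blast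
    have "uniformly_continuous_on {- real M..real M} g0"
      using g0 by (intro compact_uniformly_continuous)
        (auto simp: band_limited_def intro: continuous_on_subset)
    then obtain \<delta> where \<delta>: "0 < \<delta>"
      "\<And>x y. \<bar>x\<bar> \<le> real M \<Longrightarrow> \<bar>y\<bar> \<le> real M \<Longrightarrow> \<bar>x - y\<bar> < \<delta> \<Longrightarrow> \<bar>g0 x - g0 y\<bar> < \<epsilon> / 4"
      using \<epsilon> unfolding uniformly_continuous_on_def
      by (force simp: dist_real_def abs_le_iff dest: spec[of _ "\<epsilon> / 4"])
    \<comment> \<open>the factor by which values on the window of radius \<open>M + 1\<close> can exceed the distance is
      \<open>2 ^ Suc M\<close>\<close>
    define \<eta> where "\<eta> = \<epsilon> / 4 / 2 ^ Suc M"
    have \<eta>: "0 < \<eta>" using \<epsilon> by (simp add: \<eta>_def)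
    let ?U = "M.mball g0 \<eta> \<times> ball t0 (min \<delta> 1)"
    have "shift t g \<in> M.mball (shift t0 g0) \<epsilon>"
      if g: "g \<in> M.mball g0 \<eta>" and t: "t \<in> ball t0 (min \<delta> 1)" for g t
    proof -
      have gB: "g \<in> band_limited a" and d: "bl_dist g0 g < \<eta>"
        using g by (auto simp: band_limited_dist_def)
      have t': "\<bar>t0 - t\<bar> < \<delta>" "\<bar>t0 - t\<bar> < 1" using t by (auto simp: dist_real_def)
      have "\<bar>shift t0 g0 x - shift t g x\<bar> \<le> \<epsilon> / 2" if x: "\<bar>x\<bar> \<le> real N" for x
      proof -
        have M1: "\<bar>x + t0\<bar> \<le> real M" "\<bar>x + t\<bar> \<le> real M" using x t' M by linarith+
        then have "\<bar>g0 (x + t0) - g0 (x + t)\<bar> < \<epsilon> / 4" using t' by (intro \<delta>) auto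
        moreover have "\<bar>g0 (x + t) - g (x + t)\<bar> \<le> 2 ^ Suc M * bl_dist g0 g"
          using M1 by (intro band_limited_diff_le_bl_dist[OF g0 gB]) auto
        moreover have "2 ^ Suc M * bl_dist g0 g \<le> 2 ^ Suc M * \<eta>"
          using d by (intro mult_left_mono) auto
        moreover have "2 ^ Suc M * \<eta> = \<epsilon> / 4" by (simp add: \<eta>_def)
        ultimately show ?thesis unfolding shift_def by linarith
      qed
      then have "bl_dist (shift t0 g0) (shift t g) \<le> \<epsilon> / 2 + 2 * (1 / 2) ^ N"
        using \<epsilon> by (intro bl_dist_le[of _ a] shift_band_limited g0 gB) auto
      also have "\<dots> < \<epsilon>" using N \<epsilon> by linarith
      finally show ?thesis
        using shift_band_limited[OF g0] shift_band_limited[OF gB]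
        by (simp add: band_limited_dist_def)
    qed
    moreover have "openin (prod_topology M.mtopology euclideanreal) ?U"
      by (simp add: openin_prod_Times_iff)
    moreover have "p0 \<in> ?U" using \<delta>(1) g0 \<eta> by (simp add: p0_eq)
    ultimately show ?thesis by (intro exI[of _ ?U]) (auto simp: p0_eq)
  qed
  then show ?thesis
    unfolding band_limited_space_def M.continuous_map_to_metric by blast
qed


section \<open>The suspension with roof function one\<close>

lemma continuous_map_quotient_proj:
  "continuous_map X (quotient_topology X R) (\<lambda>x. R `` {x})"
  unfolding continuous_map by (auto simp: openin_quotient_topology intro: quotientI)

lemma continuous_map_from_quotient:
  assumes g: "continuous_map X Y g" and H: "\<And>x. x \<in> topspace X \<Longrightarrow> H (R `` {x}) = g x"
  shows "continuous_map (quotient_topology X R) Y H"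
  unfolding continuous_map
proof (intro conjI allI impI)
  show "H ` topspace (quotient_topology X R) \<subseteq> topspace Y"
    using continuous_map_image_subset_topspace[OF g] H by (auto simp: quotient_def)
next
  fix V assume "openin Y V"
  then have "openin X {x \<in> topspace X. g x \<in> V}" using g by (simp add: continuous_map)
  moreover have "{x \<in> topspace X. R `` {x} \<in> {c \<in> topspace X // R. H c \<in> V}}
      = {x \<in> topspace X. g x \<in> V}"
    using H by (auto intro: quotientI)
  ultimately show "openin (quotient_topology X R) {c \<in> topspace (quotient_topology X R). H c \<in> V}"
    by (simp add: openin_quotient_topology)
qed

locale unit_suspension =
  fixes Z :: "'z topology" and T :: "'z \<Rightarrow> 'z" and f :: "'z \<Rightarrow> real"
  assumes homeo: "homeomorphic_map Z Z T"
    and roof [simp]: "x \<in> topspace Z \<Longrightarrow> f x = 1"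
begin

lemma bij: "bij_betw T (topspace Z) (topspace Z)"
  using homeo
  by (simp add: bij_betw_def homeomorphic_imp_injective_map homeomorphic_imp_surjective_map)

lemma T_in [simp]: "x \<in> topspace Z \<Longrightarrow> T x \<in> topspace Z"
  using bij by (auto simp: bij_betw_def)

lemma inv_in: "x \<in> topspace Z \<Longrightarrow> inv_into (topspace Z) T x \<in> topspace Z"
  using bij by (metis bij_betw_def inv_into_into)

lemma inv_funpow_in: "x \<in> topspace Z \<Longrightarrow> (inv_into (topspace Z) T ^^ k) x \<in> topspace Z"
  by (induction k) (auto simp: inv_in)

lemma int_iterate_in [simp]:
  assumes "x \<in> topspace Z" shows "int_iterate Z T n x \<in> topspace Z"
proof -
  have "(T ^^ k) x \<in> topspace Z" for k
    by (induction k) (auto simp: assms)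
  then show ?thesis by (simp add: int_iterate_def inv_funpow_in assms)
qed

lemma int_iterate_0 [simp]: "int_iterate Z T 0 x = x"
  by (simp add: int_iterate_def)

lemma int_iterate_T:
  assumes "x \<in> topspace Z" shows "int_iterate Z T n (T x) = int_iterate Z T (n + 1) x"
proof (cases "0 \<le> n")
  case True
  then have "nat (n + 1) = Suc (nat n)" by simp
  with True show ?thesis by (simp add: int_iterate_def funpow_swap1)
next
  case False
  then have k: "nat (- n) = Suc (nat (- (n + 1)))" by simp
  have "inv_into (topspace Z) T (T x) = x"
    using bij assms by (simp add: bij_betw_def)
  with False k show ?thesis
    by (cases "n = - 1") (auto simp: int_iterate_def funpow_swap1)
qed

lemma T_int_iterate:
  assumes "x \<in> topspace Z" shows "T (int_iterate Z T n x) = int_iterate Z T (n + 1) x"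
proof (cases "0 \<le> n")
  case True
  then have "nat (n + 1) = Suc (nat n)" by simp
  with True show ?thesis by (simp add: int_iterate_def)
next
  case False
  then have k: "nat (- n) = Suc (nat (- (n + 1)))" by simp
  define y where "y = (inv_into (topspace Z) T ^^ nat (- (n + 1))) x"
  have "y \<in> topspace Z"
    unfolding y_def by (rule inv_funpow_in[OF assms])
  then have "T (inv_into (topspace Z) T y) = y"
    using bij by (simp add: bij_betw_def f_inv_into_f)
  with False k show ?thesis
    by (cases "n = - 1") (auto simp: int_iterate_def y_def)
qed

abbreviation "sdom \<equiv> suspension_domain Z f"

abbreviation "cls p \<equiv> suspension_rel Z T f `` {p}"

text \<open>The representative whose time lies in \<open>[0, 1)\<close>. It is defined for all times, since the flow
  leaves the fundamental domain.\<close>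

fun rep :: "'z \<times> real \<Rightarrow> 'z \<times> real" where
  "rep (x, t) = (int_iterate Z T \<lfloor>t\<rfloor> x, frac t)"

lemma sdom_iff [simp]: "(x, t) \<in> sdom \<longleftrightarrow> x \<in> topspace Z \<and> 0 \<le> t \<and> t \<le> 1"
  by (auto simp: suspension_domain_def)

lemma rep_in_sdom: "x \<in> topspace Z \<Longrightarrow> rep (x, t) \<in> sdom"
  by (simp add: less_imp_le[OF frac_lt_1])

lemma rep_id: "0 \<le> t \<Longrightarrow> t < 1 \<Longrightarrow> rep (x, t) = (x, t)"
  by (simp add: frac_eq floor_eq_iff[THEN iffD2, of 0 t])

lemma rep_rep: "rep (rep p) = rep p"
proof (cases p)
  case (Pair x t)
  have "rep (int_iterate Z T \<lfloor>t\<rfloor> x, frac t) = (int_iterate Z T \<lfloor>t\<rfloor> x, frac t)"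
    by (intro rep_id frac_ge_0 frac_lt_1)
  then show ?thesis by (simp only: Pair rep.simps)
qed

text \<open>Every function that respects a single identification respects the equivalence they generate.
  It is applied to the normal form, to the normal form of a translate, and to
  \<open>(x, t) \<mapsto> shift t (h x)\<close>.\<close>

lemma equivclp_step_invariant:
  assumes "equivclp (suspension_step Z T f) p q"
    and "\<And>x t. x \<in> topspace Z \<Longrightarrow> F (x, t) = F (T x, t - 1)"
  shows "F p = F q"
  using assms(1)
proof (induction rule: equivclp_induct)
  case (step y z)
  then show ?case using assms(2) by (auto simp: suspension_step.simps)
qed simp

lemma equivclp_step_imp_rep_eq:
  "equivclp (suspension_step Z T f) p q \<Longrightarrow> rep p = rep q"
  by (erule equivclp_step_invariant) (simp add: int_iterate_T frac_def)

lemma equivclp_step_int_iterate: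
  assumes x: "x \<in> topspace Z"
  shows "equivclp (suspension_step Z T f) (x, t) (int_iterate Z T n x, t - of_int n)"
proof -
  have step: "suspension_step Z T f (int_iterate Z T n x, t - of_int n)
      (int_iterate Z T (n + 1) x, t - of_int (n + 1))" for n
    using suspension_step.intros[of "int_iterate Z T n x" Z T f "t - of_int n"] x
    by (simp add: T_int_iterate algebra_simps)
  show ?thesis
  proof (induction n rule: int_induct[where k = 0])
    case base
    then show ?case by (simp add: equivclp_refl)
  next
    case (step1 i)
    then show ?case using step[of i] by (blast intro: equivclp_into_equivclp)
  next
    case (step2 i)
    then show ?case using step[of "i - 1"] by (auto intro: equivclp_into_equivclp)
  qed
qed

lemma equivclp_step_rep:
  "x \<in> topspace Z \<Longrightarrow> equivclp (suspension_step Z T f) (x, t) (rep (x, t))"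
  using equivclp_step_int_iterate[of x t "\<lfloor>t\<rfloor>"] by (simp add: frac_def)

lemma equivclp_step_iff_rep_eq:
  assumes "x \<in> topspace Z" "y \<in> topspace Z"
  shows "equivclp (suspension_step Z T f) (x, t) (y, u) \<longleftrightarrow> rep (x, t) = rep (y, u)"
  using equivclp_step_rep[OF assms(1), of t] equivclp_step_rep[OF assms(2), of u]
    equivclp_step_imp_rep_eq
  by (metis equivclp_sym equivclp_trans)

text \<open>The identification commutes with time translation, which makes the flow independent of the
  representative of a point.\<close>

lemma rep_add:
  assumes "x \<in> topspace Z" "y \<in> topspace Z" "rep (x, s) = rep (y, u)"
  shows "rep (x, s + r) = rep (y, u + r)"
proof -
  have "equivclp (suspension_step Z T f) (x, s) (y, u)"
    using assms by (simp add: equivclp_step_iff_rep_eq del: rep.simps)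
  then have "(\<lambda>(x, t). rep (x, t + r)) (x, s) = (\<lambda>(x, t). rep (x, t + r)) (y, u)"
  proof (rule equivclp_step_invariant)
    fix x and t :: real assume "x \<in> topspace Z"
    then have "suspension_step Z T f (x, t + r) (T x, t - 1 + r)"
      using suspension_step.intros[of x Z T f "t + r"] by (simp add: algebra_simps)
    then show "(case (x, t) of (x, t) \<Rightarrow> rep (x, t + r)) = (case (T x, t - 1) of (x, t) \<Rightarrow> rep (x, t + r))"
      using equivclp_step_imp_rep_eq by (simp add: r_into_equivclp del: rep.simps)
  qed
  then show ?thesis by simp
qed

lemma equivclp_glue_rep:
  assumes "p \<in> sdom" shows "equivclp (suspension_glue Z T f) p (rep p)"
proof -
  obtain x t where p: "p = (x, t)" by force
  with assms have x: "x \<in> topspace Z" and t: "0 \<le> t" "t \<le> 1" by auto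
  show ?thesis
  proof (cases "t = 1")
    case True
    have "rep p = (T x, 0)"
      using T_int_iterate[OF x, of 0] True by (simp add: p)
    moreover have "suspension_glue Z T f (x, 1) (T x, 0)"
      using suspension_glue.intros[of x Z T f] x by simp
    ultimately show ?thesis using True p by (simp add: r_into_equivclp)
  next
    case False
    with t have "rep p = p" by (simp add: p rep_id del: rep.simps)
    then show ?thesis by (simp add: equivclp_refl)
  qed
qed

text \<open>A gluing is an instance of the identification on \<open>Z \<times> \<real>\<close>, so glued points have the same normal
  form. Conversely, a point of the domain is either in normal form or of the form \<open>(x, 1)\<close>, which
  one gluing brings into normal form.\<close>

lemma suspension_rel_iff: "(p, q) \<in> suspension_rel Z T f \<longleftrightarrow> p \<in> sdom \<and> q \<in> sdom \<and> rep p = rep q"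
proof -
  have "equivclp (suspension_step Z T f) p q" if "equivclp (suspension_glue Z T f) p q"
    using that
  proof (induction rule: equivclp_induct)
    case (step y z)
    have "suspension_step Z T f u v" if "suspension_glue Z T f u v" for u v
      using that
    proof cases
      case (1 x)
      then show ?thesis using suspension_step.intros[of x Z T f "f x"] by simp
    qed
    with step show ?case by (blast intro: equivclp_into_equivclp)
  qed (rule equivclp_refl)
  then have "rep p = rep q" if "equivclp (suspension_glue Z T f) p q"
    using that equivclp_step_imp_rep_eq by blast
  moreover have "equivclp (suspension_glue Z T f) p q" if "p \<in> sdom" "q \<in> sdom" "rep p = rep q"
    using that equivclp_glue_rep by (metis equivclp_sym equivclp_trans)
  ultimately show ?thesis by (auto simp: suspension_rel_def)
qed

lemma cls_eq: "p \<in> sdom \<Longrightarrow> cls p = {q \<in> sdom. rep q = rep p}"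
  by (auto simp: suspension_rel_iff)

lemma cls_eq_iff: "p \<in> sdom \<Longrightarrow> q \<in> sdom \<Longrightarrow> cls p = cls q \<longleftrightarrow> rep p = rep q"
  by (auto simp: cls_eq)

lemma topspace_domain:
  "topspace (subtopology (prod_topology Z euclideanreal) sdom) = sdom"
  by (auto simp: suspension_domain_def)

lemma topspace_suspension [simp]: "topspace (suspension Z T f) = sdom // suspension_rel Z T f"
  by (simp only: suspension_def topspace_quotient_topology topspace_domain)

lemma suspension_pointE:
  assumes "c \<in> topspace (suspension Z T f)"
  obtains x s where "(x, s) \<in> sdom" "c = cls (x, s)"
proof -
  from assms obtain p where "p \<in> sdom" "c = cls p"
    by (auto elim: quotientE simp del: sdom_iff)
  then show thesis using that[of "fst p" "snd p"] by (simp del: sdom_iff)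
qed

lemma suspension_flow_cls:
  assumes "(x, s) \<in> sdom"
  shows "suspension_flow Z T f r (cls (x, s)) = cls (rep (x, s + r))"
proof -
  have x: "x \<in> topspace Z" using assms by simp
  have "(\<exists>(y, u)\<in>cls (x, s). equivclp (suspension_step Z T f) (y, u + r) q) \<longleftrightarrow> rep q = rep (x, s + r)"
    if q: "q \<in> sdom" for q
  proof
    assume "\<exists>(y, u)\<in>cls (x, s). equivclp (suspension_step Z T f) (y, u + r) q"
    then obtain y u where yu: "(y, u) \<in> sdom" "rep (y, u) = rep (x, s)"
      and e: "equivclp (suspension_step Z T f) (y, u + r) q"
      using assms by (auto simp: cls_eq simp del: rep.simps)
    have "y \<in> topspace Z" using yu(1) by simp
    with rep_add[OF x] yu(2) have "rep (y, u + r) = rep (x, s + r)" by metis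
    with equivclp_step_imp_rep_eq[OF e] show "rep q = rep (x, s + r)" by simp
  next
    assume "rep q = rep (x, s + r)"
    then have "equivclp (suspension_step Z T f) (x, s + r) q"
      using x q by (cases q) (simp add: equivclp_step_iff_rep_eq del: rep.simps)
    moreover have "(x, s) \<in> cls (x, s)" using assms by (simp add: cls_eq del: rep.simps)
    ultimately show "\<exists>(y, u)\<in>cls (x, s). equivclp (suspension_step Z T f) (y, u + r) q" by blast
  qed
  then show ?thesis
    using cls_eq[OF rep_in_sdom[OF x]]
    by (auto simp: suspension_flow_def rep_rep simp del: rep.simps)
qed


section \<open>Strong embeddings and embeddings of the suspension\<close>

text \<open>The map \<open>[x, t] \<mapsto> shift t (h x)\<close> is continuous because the quotient topology only asks for
  continuity upstairs, where the map is the joint action composed with \<open>h\<close>. Strongness of the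
  embedding is what makes it injective.\<close>

lemma strong_embedding_imp_flow_embedding:
  assumes "strongly_embeds Z T a"
  shows "flow_embeds (suspension Z T f) (suspension_flow Z T f) a"
proof -
  obtain h where h: "continuous_map Z (band_limited_space a) h"
    and hT: "\<And>x. x \<in> topspace Z \<Longrightarrow> h (T x) = shift 1 (h x)"
    and strong: "\<And>x x' r. x \<in> topspace Z \<Longrightarrow> x' \<in> topspace Z \<Longrightarrow> shift r (h x) = h x' \<Longrightarrow>
             \<exists>n::int. r = of_int n \<and> x' = int_iterate Z T n x"
    using assms unfolding strongly_embeds_def by metis
  define G where "G p = shift (snd p) (h (fst p))" for p
  define H where "H c = G (SOME p. p \<in> c)" for c
  have G_step: "G p = G q" if "equivclp (suspension_step Z T f) p q" for p q
    by (rule equivclp_step_invariant[OF that]) (simp add: G_def hT)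
  have G_rep: "G (rep (x, t)) = G (x, t)" if "x \<in> topspace Z" for x t
    using G_step[OF equivclp_step_rep[OF that]] by simp
  have H_cls: "H (cls p) = G p" if p: "p \<in> sdom" for p
  proof -
    have "p \<in> cls p" using p by (simp add: cls_eq)
    then have "(SOME q. q \<in> cls p) \<in> cls p" by (rule someI)
    then have "(SOME q. q \<in> cls p) \<in> sdom" "rep (SOME q. q \<in> cls p) = rep p"
      using p by (auto simp: cls_eq)
    then show ?thesis
      using p G_rep unfolding H_def by (metis sdom_iff surj_pair)
  qed
  have "continuous_map (prod_topology Z euclideanreal) (band_limited_space a)
      ((\<lambda>(g, t). shift t g) \<circ> (\<lambda>p. (h (fst p), snd p)))"
    by (rule continuous_map_compose[OF _ continuous_map_shift])
      (auto intro!: continuous_map_pairedI continuous_map_compose[OF continuous_map_fst h, unfolded o_def]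
        continuous_map_snd)
  then have "continuous_map (prod_topology Z euclideanreal) (band_limited_space a) G"
    by (simp add: o_def G_def[abs_def])
  then have "continuous_map (suspension Z T f) (band_limited_space a) H"
    unfolding suspension_def
    by (intro continuous_map_from_quotient[where g = G] continuous_map_from_subtopology)
      (simp_all only: topspace_domain H_cls)
  moreover have "inj_on H (topspace (suspension Z T f))"
  proof (rule inj_onI)
    fix c c' assume c: "c \<in> topspace (suspension Z T f)" "c' \<in> topspace (suspension Z T f)"
      and eq: "H c = H c'"
    obtain x s x' s' where p: "(x, s) \<in> sdom" "c = cls (x, s)" "(x', s') \<in> sdom" "c' = cls (x', s')"
      using c by (metis suspension_pointE)
    then have x: "x \<in> topspace Z" "x' \<in> topspace Z" by auto
    have "shift (- s') (shift s (h x)) = shift (- s') (shift s' (h x'))"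
      using eq p H_cls by (simp add: G_def)
    then have "shift (s - s') (h x) = h x'" by simp
    from strong[OF x this] obtain n :: int where n: "s - s' = of_int n" "x' = int_iterate Z T n x"
      by blast
    have "rep (x', s') = rep (x, s)"
      using equivclp_step_imp_rep_eq[OF equivclp_step_int_iterate[OF x(1), of s n]]
      by (simp add: n(2) flip: n(1) del: rep.simps)
    then show "c = c'" using p by (simp add: cls_eq_iff del: rep.simps)
  qed
  moreover have "H (suspension_flow Z T f r c) = shift r (H c)"
    if c: "c \<in> topspace (suspension Z T f)" for r c
  proof -
    obtain x s where p: "(x, s) \<in> sdom" "c = cls (x, s)"
      using c by (rule suspension_pointE)
    then have x: "x \<in> topspace Z" by simp
    have "H (suspension_flow Z T f r c) = G (x, s + r)"
      using p x by (simp add: suspension_flow_cls H_cls rep_in_sdom G_rep del: rep.simps)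
    also have "\<dots> = shift r (H c)"
      using p by (simp add: H_cls G_def add.commute)
    finally show ?thesis .
  qed
  ultimately show ?thesis unfolding flow_embeds_def by blast
qed

text \<open>The map \<open>h\<close> is the restriction of \<open>H\<close> to the cross-section \<open>t = 0\<close>. If \<open>shift r\<close> maps
  \<open>h x\<close> to \<open>h x'\<close>, then by injectivity of \<open>H\<close> the orbit of \<open>[x, 0]\<close> meets the cross-section at time
  \<open>r\<close>, in \<open>[x', 0]\<close>; this happens only at integer times, and only at iterates of \<open>x\<close>.\<close>

lemma flow_embedding_imp_strong_embedding:
  assumes "flow_embeds (suspension Z T f) (suspension_flow Z T f) a"
  shows "strongly_embeds Z T a"
proof -
  obtain H where H: "continuous_map (suspension Z T f) (band_limited_space a) H"
    and inj: "inj_on H (topspace (suspension Z T f))"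
    and flow: "\<And>r p. p \<in> topspace (suspension Z T f) \<Longrightarrow> H (suspension_flow Z T f r p) = shift r (H p)"
    using assms unfolding flow_embeds_def by metis
  define h where "h x = H (cls (x, 0))" for x
  have cls_in: "cls p \<in> topspace (suspension Z T f)" if "p \<in> sdom" for p
    using that by (simp add: quotientI)
  have H_inj: "rep p = rep q" if "H (cls p) = H (cls q)" "p \<in> sdom" "q \<in> sdom" for p q
    using that inj_onD[OF inj that(1)] cls_in cls_eq_iff by metis
  have rep0: "rep (x, 0) = (x, 0)" for x by (simp add: rep_id)
  have shift_h: "shift r (h x) = H (cls (rep (x, r)))" if "x \<in> topspace Z" for x r
    using flow[OF cls_in, of "(x, 0)" r] that suspension_flow_cls[of x 0 r]
    by (simp add: h_def del: rep.simps)
  have "continuous_map Z (subtopology (prod_topology Z euclideanreal) sdom) (\<lambda>x. (x, 0))"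
    by (auto simp: continuous_map_in_subtopology intro!: continuous_map_pairedI)
  then have "continuous_map Z (band_limited_space a) (H \<circ> ((\<lambda>p. cls p) \<circ> (\<lambda>x. (x, 0))))"
    using continuous_map_quotient_proj[of _ "suspension_rel Z T f"] H
    by (intro continuous_map_compose) (auto simp: suspension_def)
  then have "continuous_map Z (band_limited_space a) h"
    by (simp add: o_def h_def[abs_def])
  moreover have "inj_on h (topspace Z)"
  proof (rule inj_onI)
    fix x y assume "x \<in> topspace Z" "y \<in> topspace Z" "h x = h y"
    then have "rep (x, 0) = rep (y, 0)" unfolding h_def by (intro H_inj) auto
    then show "x = y" by (simp only: rep0 prod.inject)
  qed
  moreover have "h (T x) = shift 1 (h x)" if x: "x \<in> topspace Z" for x
  proof -
    have "rep (x, 1) = (T x, 0)"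
      using T_int_iterate[OF x, of 0] by simp
    with shift_h[OF x, of 1] show ?thesis by (simp add: h_def)
  qed
  moreover have "\<exists>n::int. r = of_int n \<and> x' = int_iterate Z T n x"
    if x: "x \<in> topspace Z" "x' \<in> topspace Z" and eq: "shift r (h x) = h x'" for x x' r
  proof -
    have "H (cls (rep (x, r))) = H (cls (x', 0))"
      using eq shift_h[OF x(1)] by (simp add: h_def)
    then have "rep (rep (x, r)) = rep (x', 0)"
      using x rep_in_sdom by (intro H_inj) auto
    then have "rep (x, r) = (x', 0)"
      by (simp only: rep_rep rep0)
    then show ?thesis by (intro exI[of _ "\<lfloor>r\<rfloor>"]) (auto simp: frac_def)
  qed
  ultimately show ?thesis unfolding strongly_embeds_def by blast
qed

end

theorem theorem6p1:
  fixes Z :: "'z topology" and T :: "'z \<Rightarrow> 'z" and f :: "'z \<Rightarrow> real" and a :: real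
  assumes "discrete_system Z T"
    and "\<forall>x\<in>topspace Z. f x = 1"
    and "a > 0"
  shows "strongly_embeds Z T a \<longleftrightarrow> flow_embeds (suspension Z T f) (suspension_flow Z T f) a"
proof -
  interpret unit_suspension Z T f
    using assms by unfold_locales (auto simp: discrete_system_def)
  show ?thesis
    using strong_embedding_imp_flow_embedding flow_embedding_imp_strong_embedding by blast
qed

end
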